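(* Let $a\in\mathbb{R}$, $0<\nu<1$, $p:\mathbb{N}_{a+1}\to(0,\infty)$, $q:\mathbb{N}_{a+1}\to\mathbb{R}$, and let $L_a$ be the operator $(L_ax)(t)=\nabla[p(t+1)\nabla_{a*}^{\nu}x(t+1)]+q(t)x(t)$, $t\in\mathbb{N}_{a+1}$, acting on functions $x:\mathbb{N}_a\to\mathbb{R}$. Let $A,B\in\mathbb{R}$ and let $h:\mathbb{N}_{a+1}\to\mathbb{R}$. Then the initial value problem $$L_ax(t)=h(t)\ \ (t\in\mathbb{N}_{a+1}),\qquad x(a)=A,\qquad \nabla x(a+1)=B,$$ has a unique solution $x:\mathbb{N}_a\to\mathbb{R}$.
   Context: For $a\in\mathbb{R}$, $\mathbb{N}_a=\{a,a+1,a+2,\dots\}$. The nabla difference is $\nabla f(t)=f(t)-f(t-1)$. The generalized rising function is $t^{\overline{\mu}}=\Gamma(t+\mu)/\Gamma(t)$, with the convention $t^{\overline{\mu}}=0$ if $t$ is a non-positive integer and $t+\mu$ is not a non-positive integer. For $\mu>0$ and $f:\mathbb{N}_{a+1}\to\mathbb{R}$, the nabla fractional sum is $\nabla_a^{-\mu}f(t)=\sum_{s=a+1}^t\frac{(t-s+1)^{\overline{\mu-1}}}{\Gamma(\mu)}f(s)$ for $t\in\mathbb{N}_a$ (empty sums are $0$). For $0<\nu<1$ and $x:\mathbb{N}_a\to\mathbb{R}$, the Caputo nabla fractional difference based at $a$ is $\nabla_{a*}^{\nu}x(t)=\nabla_a^{-(1-\nu)}(\nabla x)(t)=\sum_{\tau=a+1}^{t}\frac{(t-\tau+1)^{\overline{-\nu}}}{\Gamma(1-\nu)}\nabla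 x(\tau)$ for $t\in\mathbb{N}_a$; $\nabla_{a*}^{\nu}x(t+1)$ denotes its value at $t+1$. In $L_a$ the outer $\nabla$ acts in $t$, so $\nabla[p(t+1)\nabla_{a*}^{\nu}x(t+1)]=p(t+1)\nabla_{a*}^{\nu}x(t+1)-p(t)\nabla_{a*}^{\nu}x(t)$. *)

theory Defs
  imports "HOL-Analysis.Analysis"
begin

definition nats_from :: "real \<Rightarrow> real set" where
  "nats_from a = {a + real n | n. True}"

(* Functions on nats_from a are total functions real => real of which only the values
   on nats_from a matter; where such a function is quantified by "exists exactly one",
   it has to be taken in the extensional function space over nats_from a. *)

definition nabla :: "(real \<Rightarrow> real) \<Rightarrow> real \<Rightarrow> real" where
  "nabla f t = f t - f (t - 1)"

(* Elsewhere at poles the quotient is undefined mathematically; it takes the value 0 here,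
   as Gamma is 0 at its poles. The sums below only evaluate it at t >= 1 and t + \<mu> > 0. *)
definition rising :: "real \<Rightarrow> real \<Rightarrow> real" where
  "rising t \<mu> =
     (if t \<in> \<int>\<^sub>\<le>\<^sub>0 \<and> t + \<mu> \<notin> \<int>\<^sub>\<le>\<^sub>0 then 0 else Gamma (t + \<mu>) / Gamma t)"

definition nabla_sum :: "real \<Rightarrow> real \<Rightarrow> (real \<Rightarrow> real) \<Rightarrow> real \<Rightarrow> real" where
  "nabla_sum a \<mu> f t =
     (\<Sum>s \<in> nats_from (a + 1) \<inter> {..t}. rising (t - s + 1) (\<mu> - 1) / Gamma \<mu> * f s)"

definition caputo_nabla :: "real \<Rightarrow> real \<Rightarrow> (real \<Rightarrow> real) \<Rightarrow> real \<Rightarrow> real" where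
  "caputo_nabla a \<nu> x t = nabla_sum a (1 - \<nu>) (nabla x) t"

definition L_op ::
  "real \<Rightarrow> real \<Rightarrow> (real \<Rightarrow> real) \<Rightarrow> (real \<Rightarrow> real) \<Rightarrow> (real \<Rightarrow> real) \<Rightarrow> real \<Rightarrow> real" where
  "L_op a \<nu> p q x t =
     nabla (\<lambda>s. p (s + 1) * caputo_nabla a \<nu> x (s + 1)) t + q t * x t"

lemma finite_nats_from_atMost: "finite (nats_from a \<inter> {..t})"
proof (rule finite_subset)
  show "nats_from a \<inter> {..t} \<subseteq> (\<lambda>n. a + real n) ` {..nat \<lceil>t - a\<rceil>}"
  proof
    fix s assume "s \<in> nats_from a \<inter> {..t}"
    then obtain n where n: "s = a + real n" "a + real n \<le> t"
      by (auto simp: nats_from_def)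
    then have "n \<le> nat \<lceil>t - a\<rceil>" by linarith
    with n show "s \<in> (\<lambda>n. a + real n) ` {..nat \<lceil>t - a\<rceil>}" by blast
  qed
qed simp

lemma caputo_nabla_eq:
  "caputo_nabla a \<nu> x t =
     (\<Sum>s \<in> nats_from (a + 1) \<inter> {..t}. rising (t - s + 1) (- \<nu>) / Gamma (1 - \<nu>) * nabla x s)"
  by (simp add: caputo_nabla_def nabla_sum_def)

lemma L_op_eq:
  "L_op a \<nu> p q x t =
     p (t + 1) * caputo_nabla a \<nu> x (t + 1) - p t * caputo_nabla a \<nu> x t + q t * x t"
  by (simp add: L_op_def nabla_def)

end

theory Submission
  imports Defs
begin

text \<open>
  Since the kernel of the Caputo nabla sum equals 1 on the diagonal, the value
  \<open>x (t + 1)\<close> occurs in the equation at \<open>t\<close> with the coefficient \<open>p (t + 1) \<noteq> 0\<close>, next to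
  values of \<open>x\<close> at earlier points only. So the initial value problem is a recursion that
  expresses each value by the preceding ones.
\<close>

lemma nats_from_iff: "t \<in> nats_from a \<longleftrightarrow> (\<exists>n. t = a + real n)"
  by (auto simp: nats_from_def)

lemma nats_from_Suc_iff: "t \<in> nats_from (a + 1) \<longleftrightarrow> (\<exists>n. t = a + real (Suc n))"
  by (auto simp: nats_from_iff algebra_simps)

text \<open>The argument is the lag \<open>t - s\<close>, a natural number whenever \<open>t\<close>
  and \<open>s \<le> t\<close> both lie on the grid.\<close>

definition caputo_kernel :: "real \<Rightarrow> nat \<Rightarrow> real" where
  "caputo_kernel \<nu> n = rising (real n + 1) (- \<nu>) / Gamma (1 - \<nu>)"

text \<open>At lag 0 the rising function is \<open>Gamma (1 - \<nu>) / Gamma 1\<close>, which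
  cancels against the normalising factor; that factor is nonzero because
  \<open>\<nu> < 1\<close>.\<close>

lemma caputo_kernel_0:
  assumes "\<nu> < 1"
  shows "caputo_kernel \<nu> 0 = 1"
proof -
  have "Gamma (1 - \<nu>) > 0"
    using assms by (intro Gamma_real_pos) simp
  moreover have "(1::real) \<notin> \<int>\<^sub>\<le>\<^sub>0"
    by (auto elim!: nonpos_Ints_cases)
  ultimately show ?thesis
    by (simp add: caputo_kernel_def rising_def)
qed

text \<open>The Caputo difference in terms of the sequence \<open>y k = x (a + k)\<close>. Index
  \<open>k\<close> stands for the summation point \<open>a + Suc k\<close>, hence the lag
  \<open>n - Suc k\<close>.\<close>

definition caputo_seq :: "real \<Rightarrow> nat \<Rightarrow> (nat \<Rightarrow> real) \<Rightarrow> real" where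
  "caputo_seq \<nu> n y = (\<Sum>k<n. caputo_kernel \<nu> (n - Suc k) * (y (Suc k) - y k))"

lemma caputo_seq_cong:
  assumes "\<And>k. k \<le> n \<Longrightarrow> y k = z k"
  shows "caputo_seq \<nu> n y = caputo_seq \<nu> n z"
  unfolding caputo_seq_def by (intro sum.cong) (auto simp: assms)

lemma caputo_nabla_eq_caputo_seq:
  "caputo_nabla a \<nu> x (a + real n) = caputo_seq \<nu> n (\<lambda>k. x (a + real k))"
proof -
  have set_eq: "nats_from (a + 1) \<inter> {..a + real n} = (\<lambda>k. a + real (Suc k)) ` {..<n}"
    by (auto simp: nats_from_Suc_iff)
  have "inj_on (\<lambda>k. a + real (Suc k)) {..<n}"
    by (auto simp: inj_on_def)
  then show ?thesis
    unfolding caputo_nabla_eq set_eq caputo_seq_def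
    by (subst sum.reindex)
      (auto intro!: sum.cong simp: caputo_kernel_def nabla_def of_nat_diff algebra_simps)
qed

text \<open>The terms of \<^const>\<open>caputo_seq\<close> at \<open>Suc n\<close> that do not involve \<open>y (Suc n)\<close>.\<close>

definition caputo_history :: "real \<Rightarrow> nat \<Rightarrow> (nat \<Rightarrow> real) \<Rightarrow> real" where
  "caputo_history \<nu> n y = (\<Sum>k<n. caputo_kernel \<nu> (n - k) * (y (Suc k) - y k)) - y n"

lemma caputo_history_cong:
  assumes "\<And>k. k \<le> n \<Longrightarrow> y k = z k"
  shows "caputo_history \<nu> n y = caputo_history \<nu> n z"
proof -
  have "(\<Sum>k<n. caputo_kernel \<nu> (n - k) * (y (Suc k) - y k)) =
        (\<Sum>k<n. caputo_kernel \<nu> (n - k) * (z (Suc k) - z k))"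
    by (intro sum.cong) (auto simp: assms)
  then show ?thesis
    by (simp add: caputo_history_def assms)
qed

text \<open>The summand \<open>k = n\<close> has lag 0, so it contributes
  \<open>y (Suc n) - y n\<close> with weight 1; its part \<open>- y n\<close> belongs to the
  history.\<close>

lemma caputo_seq_Suc:
  assumes "\<nu> < 1"
  shows "caputo_seq \<nu> (Suc n) y = y (Suc n) + caputo_history \<nu> n y"
  using assms by (simp add: caputo_seq_def caputo_history_def caputo_kernel_0)

text \<open>Dependence on earlier values alone is admissibility for \<open>less_than\<close>, so
  well-founded recursion gives a fixed point; strong induction identifies any other solution with
  it.\<close>

lemma ex1_course_of_values_recursion:
  fixes F :: "(nat \<Rightarrow> 'a) \<Rightarrow> nat \<Rightarrow> 'a"
  assumes F: "\<And>n y z. (\<And>k. k < n \<Longrightarrow> y k = z k) \<Longrightarrow> F y n = F z n"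
  shows "\<exists>!y. \<forall>n. y n = F y n"
proof
  have "adm_wf less_than F"
    unfolding adm_wf_def by (auto intro: F)
  then show "\<forall>n. wfrec less_than F n = F (wfrec less_than F) n"
    by (metis wfrec_fixpoint wf_less_than)
next
  fix y assume y: "\<forall>n. y n = F y n"
  have "adm_wf less_than F"
    unfolding adm_wf_def by (auto intro: F)
  then have w: "wfrec less_than F = F (wfrec less_than F)"
    by (intro wfrec_fixpoint wf_less_than)
  have "y n = wfrec less_than F n" for n
    by (induction n rule: less_induct) (metis F y w)
  then show "y = wfrec less_than F" by blast
qed

text \<open>Sequences correspond to functions on the grid via \<open>n \<mapsto> a + n\<close>.
  Extensionality fixes the values off the grid, which \<open>P\<close> does not see.\<close>

lemma ex1_extensional_nats_from:
  assumes "\<exists>!y. P y"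
  shows "\<exists>!x. x \<in> nats_from a \<rightarrow>\<^sub>E UNIV \<and> P (\<lambda>n. x (a + real n))"
proof -
  obtain y where y: "P y" and unique: "\<And>z. P z \<Longrightarrow> z = y"
    using assms by blast
  define x where "x = restrict (\<lambda>t. y (nat \<lfloor>t - a\<rfloor>)) (nats_from a)"
  have x: "(\<lambda>n. x (a + real n)) = y"
    by (auto simp: x_def nats_from_iff)
  show ?thesis
  proof (rule ex1I[of _ x])
    show "x \<in> nats_from a \<rightarrow>\<^sub>E UNIV \<and> P (\<lambda>n. x (a + real n))"
      using x y by (simp add: x_def)
  next
    fix x' assume x': "x' \<in> nats_from a \<rightarrow>\<^sub>E UNIV \<and> P (\<lambda>n. x' (a + real n))"
    then have "(\<lambda>n. x' (a + real n)) = (\<lambda>n. x (a + real n))"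
      using unique x by simp
    then have "x' t = x t" if "t \<in> nats_from a" for t
      using that by (auto simp: nats_from_iff dest: fun_cong)
    moreover have "x \<in> nats_from a \<rightarrow>\<^sub>E UNIV"
      by (simp add: x_def)
    ultimately show "x' = x"
      using x' by (intro PiE_ext) auto
  qed
qed

theorem theorem14:
  fixes a \<nu> A B :: real and p q h :: "real \<Rightarrow> real"
  assumes "0 < \<nu>" and "\<nu> < 1"
    and "p \<in> nats_from (a + 1) \<rightarrow> {0<..}"
  shows "\<exists>!x. x \<in> nats_from a \<rightarrow>\<^sub>E (UNIV :: real set) \<and>
           (\<forall>t \<in> nats_from (a + 1). L_op a \<nu> p q x t = h t) \<and>
           x a = A \<and> nabla x (a + 1) = B"
proof -
  \<comment> \<open>The first two cases encode the initial data, as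
    \<open>x (a + 1) = A + B\<close>. The third solves the equation at \<open>a + Suc m\<close> for
    the value one point later.\<close>
  define F where "F y n = (case n of 0 \<Rightarrow> A | Suc 0 \<Rightarrow> A + B
      | Suc (Suc m) \<Rightarrow> (h (a + Suc m) + p (a + Suc m) * caputo_seq \<nu> (Suc m) y
            - q (a + Suc m) * y (Suc m)) / p (a + Suc (Suc m)) - caputo_history \<nu> (Suc m) y)"
    for y :: "nat \<Rightarrow> real" and n
  have F_cong: "F y n = F z n" if "\<And>k. k < n \<Longrightarrow> y k = z k" for y z n
  proof -
    \<comment> \<open>Both expressions read \<open>y\<close> only up to index \<open>Suc m\<close>,
      which is below \<open>n\<close>.\<close>
    have "caputo_seq \<nu> (Suc m) y = caputo_seq \<nu> (Suc m) z"
      and "caputo_history \<nu> (Suc m) y = caputo_history \<nu> (Suc m) z"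
      if "n = Suc (Suc m)" for m
      using that \<open>\<And>k. k < n \<Longrightarrow> y k = z k\<close>
      by (auto intro!: caputo_seq_cong caputo_history_cong)
    with that show ?thesis
      by (auto simp: F_def split: nat.split)
  qed
  have F_iff: "(\<forall>t \<in> nats_from (a + 1). L_op a \<nu> p q x t = h t) \<and> x a = A \<and> nabla x (a + 1) = B
      \<longleftrightarrow> (\<forall>n. x (a + real n) = F (\<lambda>k. x (a + real k)) n)" (is "_ \<longleftrightarrow> (\<forall>n. ?y n = F ?y n)") for x
  proof -
    have step: "L_op a \<nu> p q x (a + Suc m) = h (a + Suc m) \<longleftrightarrow> ?y (Suc (Suc m)) = F ?y (Suc (Suc m))"
      for m
    proof -
      have pos: "p (a + Suc (Suc m)) > 0"
        using assms(3) nats_from_Suc_iff by blast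
      have "L_op a \<nu> p q x (a + Suc m) =
          p (a + Suc (Suc m)) * (?y (Suc (Suc m)) + caputo_history \<nu> (Suc m) ?y)
          - p (a + Suc m) * caputo_seq \<nu> (Suc m) ?y + q (a + Suc m) * ?y (Suc m)"
      proof -
        have "a + real (Suc m) + 1 = a + real (Suc (Suc m))" by simp
        then show ?thesis
          unfolding L_op_eq
          by (simp only: caputo_nabla_eq_caputo_seq caputo_seq_Suc[OF assms(2), of "Suc m"])
      qed
      moreover have "F ?y (Suc (Suc m)) = (h (a + Suc m) + p (a + Suc m) * caputo_seq \<nu> (Suc m) ?y
            - q (a + Suc m) * ?y (Suc m)) / p (a + Suc (Suc m)) - caputo_history \<nu> (Suc m) ?y"
        by (simp add: F_def)
      moreover have "P * (y + H) - C + Q = r \<longleftrightarrow> y = (r + C - Q) / P - H" if "P > 0"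
        for P y H C Q r :: real
        using that by (simp add: eq_diff_eq eq_divide_eq) (auto simp: mult.commute)
      ultimately show ?thesis
        using pos by simp
    qed
    have all: "(\<forall>n. ?y n = F ?y n) \<longleftrightarrow>
        ?y 0 = F ?y 0 \<and> ?y (Suc 0) = F ?y (Suc 0) \<and> (\<forall>m. ?y (Suc (Suc m)) = F ?y (Suc (Suc m)))"
      by (metis not0_implies_Suc)
    have eq: "(\<forall>t \<in> nats_from (a + 1). L_op a \<nu> p q x t = h t) \<longleftrightarrow>
        (\<forall>m. ?y (Suc (Suc m)) = F ?y (Suc (Suc m)))"
      unfolding step[symmetric] by (metis nats_from_Suc_iff)
    \<comment> \<open>The two conditions match only jointly: \<open>F ?y (Suc 0)\<close> contains
      \<open>A\<close> where \<open>nabla\<close> has \<open>x a\<close>.\<close>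
    have init: "x a = A \<and> nabla x (a + 1) = B \<longleftrightarrow> ?y 0 = F ?y 0 \<and> ?y (Suc 0) = F ?y (Suc 0)"
      by (auto simp: F_def nabla_def)
    show ?thesis
      unfolding all eq init by blast
  qed
  have "\<exists>!y. \<forall>n. y n = F y n"
    by (rule ex1_course_of_values_recursion) (rule F_cong)
  then show ?thesis
    unfolding F_iff by (rule ex1_extensional_nats_from)
qed

end
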